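(* Let $(M,\mathcal{M},\mu)$ be a complete measure space, let $p(x,dy)$ be a Markov kernel on $M$ symmetric with respect to $\mu$, let $(\mathcal{H},d)$ be an Hadamard space, let $D\in\mathcal{M}$, and let $h\colon M\to\mathcal{H}$ be a measurable mapping. Let $P_{(D)}\colon L^2(D,\mathcal{H},h)\to L^2(D,\mathcal{H},h)$ be the nonlinear Markov operator associated with the kernel $p_D$, and let $R_\lambda$ $(\lambda>0)$ and $(T_t)_{t\ge0}$ be the resolvents and the semigroup of the nonexpansive mapping $F:=P_{(D)}$ on the Hadamard space $L^2(D,\mathcal{H},h)$. Assume that the $L^2$-Dirichlet problem for $h$ has a solution, i.e. there exists $g\in L^2(D,\mathcal{H},h)$ with $P_{(D)}g=g$. Let $f_0\in L^2(D,\mathcal{H},h)$. Then: (i) (discrete time heat flow) for every sequence $(\lambda_n)_{n\in\mathbb{N}}\subset(0,\infty)$ with $\sum_n\lambda_n^2=\infty$, the sequence defined by $f_n:=R_{\lambda_n}f_{n-1}$, $n\in\mathbb{N}$, converges weakly in $L^2(D,\mathcal{H},h)$ to a mapping $f\in L^2(D,\mathcal{H},h)$ such that $P_{(D)}f=f$; (ii) (continuous time heat flow) $T_tf_0$ converges weakly in $L^2(D,\mathcal{H},h)$, as $t\to\infty$, to a mapping $f\in L^2(D,\mathcal{H},h)$ such that $P_{(D)}f=f$.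
   Context: An Hadamard space $(X,\rho)$ is a complete geodesic metric space satisfying $$\rho(x,\gamma_t)^2\le(1-t)\rho(x,\gamma_0)^2+t\,\rho(x,\gamma_1)^2-t(1-t)\rho(\gamma_0,\gamma_1)^2$$ for any $x\in X$, any geodesic $\gamma\colon[0,1]\to X$ and any $t\in[0,1]$. Any two points $x,y\in X$ are joined by a unique geodesic, and for $t\in[0,1]$ one writes $(1-t)x+ty$ for the point $z$ on it with $\rho(x,z)=t\rho(x,y)$ and $\rho(z,y)=(1-t)\rho(x,y)$. Resolvent and semigroup of a nonexpansive (i.e. $1$-Lipschitz) mapping $F\colon X\to X$ of an Hadamard space: for $x\in X$, $\lambda>0$, $R_\lambda x$ is the unique fixed point of the strict contraction $y\mapsto\frac{1}{1+\lambda}x+\frac{\lambda}{1+\lambda}Fy$, and $R_0x=x$. It is known that $T_tx:=\lim_{n\to\infty}(R_{t/n})^nx$ exists for all $x\in X$, $t\ge0$ (uniformly for $t$ in bounded intervals), and that $(T_t)_{t\ge0}$ is a strongly continuous semigroup of nonexpansive mappings. Weak convergence in an Hadamard space $(X,\rho)$: for a bounded sequence $(x_n)\subset X$, the function $x\mapsto\limsup_{n}\rho(x,x_n)^2$ has a unique minimizer, the asymptotic center of $(x_n)$. A bounded sequence $(x_n)$ converges weakly to $x$ if $x$ is the asymptotic center of each of its subsequences. $T_tx$ converges weakly to $z$ as $t\to\infty$ if $(T_{t_n}x)$ converges weakly to $z$ for every sequence $t_n\to\infty$. Setting. $(M,\mathcal{M},\mu)$ is complete: all subsets of $\mu$-null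 sets belong to $\mathcal{M}$. For $D\in\mathcal{M}$, $L^2(D):=\{u\in L^2(M)\colon u=0\text{ a.e. on }M\setminus D\}$. $L^2(D,\mathcal{H},h)$ is the space of measurable mappings $f\colon M\to\mathcal{H}$ with $d(f(\cdot),h(\cdot))\in L^2(D)$ (mappings equal a.e. identified), with metric $d_2(f,g):=\left(\int_Md(f(x),g(x))^2\,\mu(dx)\right)^{1/2}$; it is an Hadamard space. The kernel $p$ is symmetric with respect to $\mu$: $p(x,dy)\,\mu(dx)=p(y,dx)\,\mu(dy)$. Put $$p_D(x,dy):=\chi_D(x)\,p(x,dy)+\chi_{M\setminus D}(x)\,\delta_x(dy).$$ The nonlinear Markov operator associated with $p_D$ is $$P_{(D)}f(x):=\operatorname*{arg\,min}_{z\in\mathcal{H}}\int_Md(z,f(y))^2\,p_D(x,dy),$$ so that $P_{(D)}f(x)=\operatorname*{arg\,min}_{z\in\mathcal{H}}\int_Md(z,f(y))^2\,p(x,dy)$ for $x\in D$ and $P_{(D)}f(x)=f(x)$ for $x\in M\setminus D$. It is taken as known (standing fact) that $P_{(D)}$ is a well-defined nonexpansive mapping of $L^2(D,\mathcal{H},h)$ into itself. *)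

theory Defs
  imports "HOL-Probability.Probability"
begin

section \<open>Hadamard spaces\<close>

text \<open>A metric space is given by a carrier \<open>X\<close> and a distance \<open>d\<close>, as in \<^locale>\<open>Metric_space\<close>.\<close>

definition geodesic_in :: "'b set \<Rightarrow> ('b \<Rightarrow> 'b \<Rightarrow> real) \<Rightarrow> (real \<Rightarrow> 'b) \<Rightarrow> bool" where
  "geodesic_in X d \<gamma> \<longleftrightarrow>
     \<gamma> \<in> {0..1} \<rightarrow> X \<and> (\<forall>s\<in>{0..1}. \<forall>t\<in>{0..1}. d (\<gamma> s) (\<gamma> t) = \<bar>s - t\<bar> * d (\<gamma> 0) (\<gamma> 1))"

definition hadamard_space :: "'b set \<Rightarrow> ('b \<Rightarrow> 'b \<Rightarrow> real) \<Rightarrow> bool" where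
  "hadamard_space X d \<longleftrightarrow>
     Metric_space X d \<and> Metric_space.mcomplete X d \<and>
     (\<forall>x\<in>X. \<forall>y\<in>X. \<exists>\<gamma>. geodesic_in X d \<gamma> \<and> \<gamma> 0 = x \<and> \<gamma> 1 = y) \<and>
     (\<forall>x\<in>X. \<forall>\<gamma>. geodesic_in X d \<gamma> \<longrightarrow> (\<forall>t\<in>{0..1}.
        (d x (\<gamma> t))\<^sup>2 \<le> (1 - t) * (d x (\<gamma> 0))\<^sup>2 + t * (d x (\<gamma> 1))\<^sup>2
                          - t * (1 - t) * (d (\<gamma> 0) (\<gamma> 1))\<^sup>2))"

text \<open>The point \<open>(1 - t) x + t y\<close>.\<close>

definition geo_comb :: "'b set \<Rightarrow> ('b \<Rightarrow> 'b \<Rightarrow> real) \<Rightarrow> real \<Rightarrow> 'b \<Rightarrow> 'b \<Rightarrow> 'b" where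
  "geo_comb X d t x y = (THE z. z \<in> X \<and> d x z = t * d x y \<and> d z y = (1 - t) * d x y)"

definition nonexpansive_on :: "'b set \<Rightarrow> ('b \<Rightarrow> 'b \<Rightarrow> real) \<Rightarrow> ('b \<Rightarrow> 'b) \<Rightarrow> bool" where
  "nonexpansive_on X d F \<longleftrightarrow> F \<in> X \<rightarrow> X \<and> (\<forall>x\<in>X. \<forall>y\<in>X. d (F x) (F y) \<le> d x y)"

definition resolvent ::
    "'b set \<Rightarrow> ('b \<Rightarrow> 'b \<Rightarrow> real) \<Rightarrow> ('b \<Rightarrow> 'b) \<Rightarrow> real \<Rightarrow> 'b \<Rightarrow> 'b" where
  "resolvent X d F l x =
     (if l = 0 then x else (THE y. y \<in> X \<and> y = geo_comb X d (l / (1 + l)) x (F y)))"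

definition semigroup_of ::
    "'b set \<Rightarrow> ('b \<Rightarrow> 'b \<Rightarrow> real) \<Rightarrow> ('b \<Rightarrow> 'b) \<Rightarrow> real \<Rightarrow> 'b \<Rightarrow> 'b" where
  "semigroup_of X d F t x =
     (THE z. limitin (Metric_space.mtopology X d)
               (\<lambda>n. ((resolvent X d F (t / real n)) ^^ n) x) z sequentially)"

definition is_asymptotic_center ::
    "'b set \<Rightarrow> ('b \<Rightarrow> 'b \<Rightarrow> real) \<Rightarrow> (nat \<Rightarrow> 'b) \<Rightarrow> 'b \<Rightarrow> bool" where
  "is_asymptotic_center X d s c \<longleftrightarrow> c \<in> X \<and>
     (\<forall>x\<in>X. x \<noteq> c \<longrightarrow>
        limsup (\<lambda>n. ereal ((d c (s n))\<^sup>2)) < limsup (\<lambda>n. ereal ((d x (s n))\<^sup>2)))"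

text \<open>Note that \<open>mbounded\<close> also forces the sequence to lie in \<open>X\<close>.\<close>

definition weakly_converges ::
    "'b set \<Rightarrow> ('b \<Rightarrow> 'b \<Rightarrow> real) \<Rightarrow> (nat \<Rightarrow> 'b) \<Rightarrow> 'b \<Rightarrow> bool" where
  "weakly_converges X d s z \<longleftrightarrow> Metric_space.mbounded X d (range s) \<and>
     (\<forall>r. strict_mono r \<longrightarrow> is_asymptotic_center X d (s \<circ> r) z)"

definition weakly_converges_at_top ::
    "'b set \<Rightarrow> ('b \<Rightarrow> 'b \<Rightarrow> real) \<Rightarrow> (real \<Rightarrow> 'b) \<Rightarrow> 'b \<Rightarrow> bool" where
  "weakly_converges_at_top X d u z \<longleftrightarrow>
     (\<forall>t. (\<forall>n. 0 \<le> t n) \<and> filterlim t at_top sequentially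
        \<longrightarrow> weakly_converges X d (\<lambda>n. u (t n)) z)"


section \<open>Markov kernels\<close>

definition markov_kernel :: "'a measure \<Rightarrow> ('a \<Rightarrow> 'a measure) \<Rightarrow> bool" where
  "markov_kernel M p \<longleftrightarrow> p \<in> M \<rightarrow>\<^sub>M prob_algebra M"

text \<open>\<open>p(x,dy) \<mu>(dx) = p(y,dx) \<mu>(dy)\<close> as measures on the product space.\<close>

definition symmetric_kernel :: "'a measure \<Rightarrow> ('a \<Rightarrow> 'a measure) \<Rightarrow> bool" where
  "symmetric_kernel M p \<longleftrightarrow> (\<forall>C\<in>sets (M \<Otimes>\<^sub>M M).
     (\<integral>\<^sup>+x. (\<integral>\<^sup>+y. indicator C (x, y) \<partial>p x) \<partial>M) = (\<integral>\<^sup>+y. (\<integral>\<^sup>+x. indicator C (x, y) \<partial>p y) \<partial>M))"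

definition stopped_kernel ::
    "'a measure \<Rightarrow> 'a set \<Rightarrow> ('a \<Rightarrow> 'a measure) \<Rightarrow> 'a \<Rightarrow> 'a measure" where
  "stopped_kernel M D p x = (if x \<in> D then p x else return M x)"

definition barycenter_functional ::
    "'a measure \<Rightarrow> ('a \<Rightarrow> 'h::metric_space) \<Rightarrow> 'h \<Rightarrow> ennreal" where
  "barycenter_functional q f z = (\<integral>\<^sup>+y. ennreal ((dist z (f y))\<^sup>2) \<partial>q)"

text \<open>The operator \<open>P\<^sub>(\<^sub>D\<^sub>)\<close> on functions. The value is only meaningful at those \<open>x\<close> where the
  minimizer is unique.\<close>

definition markov_op_fun ::
    "'a measure \<Rightarrow> 'a set \<Rightarrow> ('a \<Rightarrow> 'a measure) \<Rightarrow> ('a \<Rightarrow> 'h::metric_space) \<Rightarrow> 'a \<Rightarrow> 'h" where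
  "markov_op_fun M D p f x =
     arg_min (barycenter_functional (stopped_kernel M D p x) f) (\<lambda>_. True)"


section \<open>The space \<open>L\<^sup>2(D,H,h)\<close>\<close>

definition L2_on :: "'a measure \<Rightarrow> 'a set \<Rightarrow> ('a \<Rightarrow> real) set" where
  "L2_on M D = {u \<in> borel_measurable M. integrable M (\<lambda>x. (u x)\<^sup>2) \<and>
                                      (AE x in M. x \<notin> D \<longrightarrow> u x = 0)}"

definition L2_maps :: "'a measure \<Rightarrow> 'a set \<Rightarrow> ('a \<Rightarrow> 'h::metric_space) \<Rightarrow> ('a \<Rightarrow> 'h) set" where
  "L2_maps M D h = {f \<in> borel_measurable M. (\<lambda>x. dist (f x) (h x)) \<in> L2_on M D}"

definition ae_rel ::
    "'a measure \<Rightarrow> 'a set \<Rightarrow> ('a \<Rightarrow> 'h::metric_space) \<Rightarrow> (('a \<Rightarrow> 'h) \<times> ('a \<Rightarrow> 'h)) set" where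
  "ae_rel M D h = {(f, g). f \<in> L2_maps M D h \<and> g \<in> L2_maps M D h \<and> (AE x in M. f x = g x)}"

text \<open>Points of the space are classes of mappings modulo a.e. equality.\<close>

definition L2_space ::
    "'a measure \<Rightarrow> 'a set \<Rightarrow> ('a \<Rightarrow> 'h::metric_space) \<Rightarrow> ('a \<Rightarrow> 'h) set set" where
  "L2_space M D h = L2_maps M D h // ae_rel M D h"

definition rep :: "'b set \<Rightarrow> 'b" where
  "rep A = (SOME f. f \<in> A)"

definition L2_dist ::
    "'a measure \<Rightarrow> ('a \<Rightarrow> 'h::metric_space) set \<Rightarrow> ('a \<Rightarrow> 'h) set \<Rightarrow> real" where
  "L2_dist M A B = sqrt (\<integral>x. (dist (rep A x) (rep B x))\<^sup>2 \<partial>M)"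

text \<open>The operator \<open>P\<^sub>(\<^sub>D\<^sub>)\<close> on classes.\<close>

definition markov_op ::
    "'a measure \<Rightarrow> 'a set \<Rightarrow> ('a \<Rightarrow> 'h::metric_space) \<Rightarrow> ('a \<Rightarrow> 'a measure)
       \<Rightarrow> ('a \<Rightarrow> 'h) set \<Rightarrow> ('a \<Rightarrow> 'h) set" where
  "markov_op M D h p A = ae_rel M D h `` {markov_op_fun M D p (rep A)}"

text \<open>Well-definedness of \<open>P\<^sub>(\<^sub>D\<^sub>)\<close> at the level of functions: for every \<open>f\<close> the minimizer exists
  and is unique at a.e. \<open>x\<close>, and the resulting function lies in the space again.\<close>

definition markov_op_well_defined ::
    "'a measure \<Rightarrow> 'a set \<Rightarrow> ('a \<Rightarrow> 'h::metric_space) \<Rightarrow> ('a \<Rightarrow> 'a measure) \<Rightarrow> bool" where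
  "markov_op_well_defined M D h p \<longleftrightarrow> (\<forall>f\<in>L2_maps M D h.
     (AE x in M. \<exists>!z. is_arg_min (barycenter_functional (stopped_kernel M D p x) f) (\<lambda>_. True) z) \<and>
     markov_op_fun M D p f \<in> L2_maps M D h)"

end

theory Submission
  imports Defs
begin

text \<open>The theorem holds for every nonexpansive mapping \<open>F\<close> with a fixed point on an Hadamard space.
  The \<open>CAT(0)\<close> inequality gives, for a fixed point \<open>p\<close> and \<open>y = R\<^sub>\<lambda> x\<close>,
  \<open>d(p, y)\<^sup>2 + \<lambda> (1 + \<lambda>) d(y, F y)\<^sup>2 \<le> d(p, x)\<^sup>2\<close>, and \<open>d(y, F y) \<le> d(x, F x)\<close>. Hence along
  both flows the distance to every fixed point decreases and the residual \<open>d(x, F x)\<close> tends to \<open>0\<close>,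
  in continuous time because the \<open>n\<close>th approximation of \<open>T\<^sub>t x\<close> has residual at most
  \<open>d(p, x) / sqrt t\<close>. Opial's argument with asymptotic centers turns this into weak
  convergence. The limit defining \<open>T\<^sub>t\<close> exists by the Crandall--Liggett estimate.\<close>

section \<open>Convex combinations and the \<open>CAT(0)\<close> inequality\<close>

locale hadamard = Metric_space X d for X :: "'b set" and d +
  assumes hadamard: "hadamard_space X d"
begin

lemma mcomplete: mcomplete
  using hadamard by (simp add: hadamard_space_def)

abbreviation comb :: "real \<Rightarrow> 'b \<Rightarrow> 'b \<Rightarrow> 'b" where
  "comb \<equiv> geo_comb X d"

lemma geodesic_point:
  assumes "x \<in> X" "y \<in> X" "0 \<le> t" "t \<le> 1"
  obtains c where "c \<in> X" "d x c = t * d x y" "d c y = (1 - t) * d x y"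
    "\<And>w. w \<in> X \<Longrightarrow> (d w c)\<^sup>2 \<le> (1 - t) * (d w x)\<^sup>2 + t * (d w y)\<^sup>2 - t * (1 - t) * (d x y)\<^sup>2"
proof -
  obtain \<gamma> where g: "geodesic_in X d \<gamma>" "\<gamma> 0 = x" "\<gamma> 1 = y"
    using hadamard assms unfolding hadamard_space_def by blast
  have *: "d (\<gamma> s) (\<gamma> u) = \<bar>s - u\<bar> * d x y" if "s \<in> {0..1}" "u \<in> {0..1}" for s u
    using g that unfolding geodesic_in_def by metis
  show ?thesis
  proof
    show "\<gamma> t \<in> X"
      using g(1) assms by (auto simp: geodesic_in_def)
    show "d x (\<gamma> t) = t * d x y" "d (\<gamma> t) y = (1 - t) * d x y"
      using *[of 0 t] *[of t 1] assms g by auto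
    show "(d w (\<gamma> t))\<^sup>2 \<le> (1 - t) * (d w x)\<^sup>2 + t * (d w y)\<^sup>2 - t * (1 - t) * (d x y)\<^sup>2"
      if "w \<in> X" for w
      using hadamard g that assms unfolding hadamard_space_def
      by (metis atLeastAtMost_iff)
  qed
qed

text \<open>If \<open>w\<close> has the same distances to \<open>x\<close> and \<open>y\<close> as
  the geodesic point \<open>c\<close>, the \<open>CAT(0)\<close> inequality seen from
  \<open>w\<close> bounds \<open>(d w c)\<^sup>2\<close> by a multiple of (1 - t) t^2 + t (1 - t)^2
  - t (1 - t) = 0. Hence the description in \<open>geo_comb\<close> is unique, and a combination can
  be recognised from two distances.\<close>

lemma comb_eqI:
  assumes "x \<in> X" "y \<in> X" "0 \<le> t" "t \<le> 1"
    and z: "z \<in> X" "d x z = t * d x y" "d z y = (1 - t) * d x y"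
  shows "comb t x y = z"
proof -
  obtain c where c: "c \<in> X"
    "\<And>w. w \<in> X \<Longrightarrow> (d w c)\<^sup>2 \<le> (1 - t) * (d w x)\<^sup>2 + t * (d w y)\<^sup>2 - t * (1 - t) * (d x y)\<^sup>2"
    using geodesic_point[OF assms(1-4)] by metis
  have eq: "w = c" if w: "w \<in> X" "d x w = t * d x y" "d w y = (1 - t) * d x y" for w
  proof -
    have "(d w c)\<^sup>2 \<le> (1 - t) * (t * d x y)\<^sup>2 + t * ((1 - t) * d x y)\<^sup>2 - t * (1 - t) * (d x y)\<^sup>2"
      using c(2)[OF w(1)] w by (simp add: commute)
    also have "\<dots> = 0" by algebra
    finally show ?thesis using w c by simp
  qed
  show ?thesis
    unfolding geo_comb_def using z eq by (intro the_equality) blast+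
qed

lemma
  assumes "x \<in> X" "y \<in> X" "0 \<le> t" "t \<le> 1"
  shows comb_in: "comb t x y \<in> X"
    and dist_comb_left: "d x (comb t x y) = t * d x y"
    and dist_comb_right: "d (comb t x y) y = (1 - t) * d x y"
    and comb_cat0: "\<And>w. w \<in> X \<Longrightarrow> (d w (comb t x y))\<^sup>2
           \<le> (1 - t) * (d w x)\<^sup>2 + t * (d w y)\<^sup>2 - t * (1 - t) * (d x y)\<^sup>2"
proof -
  obtain c where c: "c \<in> X" "d x c = t * d x y" "d c y = (1 - t) * d x y"
    "\<And>w. w \<in> X \<Longrightarrow> (d w c)\<^sup>2 \<le> (1 - t) * (d w x)\<^sup>2 + t * (d w y)\<^sup>2 - t * (1 - t) * (d x y)\<^sup>2"
    using geodesic_point[OF assms(1-4)] by metis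
  then have eq: "comb t x y = c" using comb_eqI assms by blast
  show "comb t x y \<in> X" "d x (comb t x y) = t * d x y"
    "d (comb t x y) y = (1 - t) * d x y" 
    "\<And>w. w \<in> X \<Longrightarrow> (d w (comb t x y))\<^sup>2
           \<le> (1 - t) * (d w x)\<^sup>2 + t * (d w y)\<^sup>2 - t * (1 - t) * (d x y)\<^sup>2"
    unfolding eq using c by auto
qed

lemma comb_commute:
  assumes "x \<in> X" "y \<in> X" "0 \<le> t" "t \<le> 1"
  shows "comb t x y = comb (1 - t) y x"
  using assms dist_comb_left[of y x "1 - t"] dist_comb_right[of y x "1 - t"] comb_in[of y x "1 - t"]
  by (intro comb_eqI) (auto simp: commute)

text \<open>The \<open>CAT(0)\<close> inequality is used twice: for \<open>comb t a b'\<close> seen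
  from \<open>b\<close>, then for \<open>comb t a b\<close> seen from \<open>comb t a b'\<close>.
  Inserting the first bound into the second cancels the terms in \<open>d a b\<close> and
  \<open>d a b'\<close> and leaves exactly the square of the right-hand side.\<close>

lemma dist_comb_same_left:
  assumes "a \<in> X" "b \<in> X" "b' \<in> X" and t: "0 \<le> t" "t \<le> 1"
  shows "d (comb t a b) (comb t a b') \<le> t * d b b'"
proof (rule power2_le_imp_le)
  let ?m = "comb t a b" and ?m' = "comb t a b'"
  have in': "?m' \<in> X" using assms comb_in by blast
  have b: "(d b ?m')\<^sup>2 \<le> (1 - t) * (d a b)\<^sup>2 + t * (d b b')\<^sup>2 - t * (1 - t) * (d a b')\<^sup>2"
    using comb_cat0[OF assms(1,3) t assms(2)] by (simp add: commute)
  have "(d ?m' ?m)\<^sup>2 \<le> (1 - t) * (d ?m' a)\<^sup>2 + t * (d ?m' b)\<^sup>2 - t * (1 - t) * (d a b)\<^sup>2"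
    by (rule comb_cat0[OF assms(1,2) t in'])
  also have "\<dots> = (1 - t) * (t * d a b')\<^sup>2 + t * (d b ?m')\<^sup>2 - t * (1 - t) * (d a b)\<^sup>2"
    using dist_comb_left[OF assms(1,3) t] by (simp add: commute)
  also have "\<dots> \<le> (1 - t) * (t * d a b')\<^sup>2
      + t * ((1 - t) * (d a b)\<^sup>2 + t * (d b b')\<^sup>2 - t * (1 - t) * (d a b')\<^sup>2) - t * (1 - t) * (d a b)\<^sup>2"
    using mult_left_mono[OF b t(1)] by simp
  also have "\<dots> = (t * d b b')\<^sup>2" by algebra
  finally show "(d ?m ?m')\<^sup>2 \<le> (t * d b b')\<^sup>2" by (simp add: commute)
qed (use t in simp)

text \<open>Joint convexity of the metric: one endpoint is moved at a time, passing through
  \<open>comb t a b'\<close>.\<close>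

lemma dist_comb_le:
  assumes "a \<in> X" "b \<in> X" "a' \<in> X" "b' \<in> X" and t: "0 \<le> t" "t \<le> 1"
  shows "d (comb t a b) (comb t a' b') \<le> (1 - t) * d a a' + t * d b b'"
proof -
  have "d (comb t a b) (comb t a' b') \<le> d (comb t a b) (comb t a b') + d (comb t a b') (comb t a' b')"
    using assms by (intro triangle comb_in)
  moreover have "d (comb t a b') (comb t a' b') \<le> (1 - t) * d a a'"
    using dist_comb_same_left[of b' a a' "1 - t"] assms by (simp add: comb_commute[of _ b' t])
  ultimately show ?thesis
    using dist_comb_same_left[of a b b' t] assms by linarith
qed

end

section \<open>Resolvents of a nonexpansive mapping\<close>

locale nonexpansive_map = hadamard +
  fixes F
  assumes nonexpansive: "nonexpansive_on X d F"
begin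

lemma F_in: "x \<in> X \<Longrightarrow> F x \<in> X"
  using nonexpansive by (auto simp: nonexpansive_on_def)

lemma F_le: "x \<in> X \<Longrightarrow> y \<in> X \<Longrightarrow> d (F x) (F y) \<le> d x y"
  using nonexpansive by (auto simp: nonexpansive_on_def)

abbreviation J :: "real \<Rightarrow> 'a \<Rightarrow> 'a" where
  "J \<equiv> resolvent X d F"

text \<open>The map defining the resolvent contracts by the factor \<open>l / (1 + l)\<close>, which
  is less than 1, so Banach's fixed point theorem justifies the \<open>THE\<close> in
  \<open>resolvent\<close>.\<close>

lemma
  assumes x: "x \<in> X" and l: "l > 0"
  shows resolvent_in: "J l x \<in> X"
    and resolvent_fixpoint: "J l x = comb (l / (1 + l)) x (F (J l x))"
    and resolvent_unique: "\<And>y. y \<in> X \<Longrightarrow> y = comb (l / (1 + l)) x (F y) \<Longrightarrow> y = J l x"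
proof -
  let ?t = "l / (1 + l)" and ?G = "\<lambda>y. comb (l / (1 + l)) x (F y)"
  have t: "0 \<le> ?t" "?t \<le> 1" "?t < 1" using l by auto
  have G: "?G \<in> X \<rightarrow> X" using x t F_in comb_in by blast
  have con: "d (?G y) (?G z) \<le> ?t * d y z" if "y \<in> X" "z \<in> X" for y z
    using dist_comb_same_left[OF x F_in[OF that(1)] F_in[OF that(2)] t(1,2)]
      mult_left_mono[OF F_le[OF that] t(1)] by linarith
  obtain y where y: "y \<in> X" "?G y = y"
    using Banach_fixedpoint_thm[OF mcomplete _ G t(3) con] x by blast
  have uniq: "z = y" if "z \<in> X" "z = ?G z" for z
    using contraction_imp_unique_fixpoint[of ?G, OF that(2)[symmetric] y(2) G t(3) con that(1) y(1)] .
  have J: "J l x = y"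
  proof -
    have "(THE y. y \<in> X \<and> y = ?G y) = y"
      using y(1) y(2)[symmetric] uniq by (intro the_equality conjI) blast+
    then show ?thesis unfolding resolvent_def using l by simp
  qed
  show "J l x \<in> X" "J l x = comb (l / (1 + l)) x (F (J l x))"
    unfolding J using y(1) y(2)[symmetric] .
  show "z = J l x" if "z \<in> X" "z = ?G z" for z
    unfolding J using uniq that .
qed

text \<open>With the residual r of \<open>J l x\<close> as unit of length, the points
  \<open>x\<close>, \<open>J l x\<close> and \<open>F (J l x)\<close> sit at 0, l and 1 + l on one
  geodesic. This form of the resolvent equation carries the later estimates.\<close>

lemma
  assumes x: "x \<in> X" and l: "l > 0"
  shows dist_resolvent: "d x (J l x) = l * d (J l x) (F (J l x))"
    and dist_resolvent': "d x (F (J l x)) = (1 + l) * d (J l x) (F (J l x))"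
proof -
  let ?y = "J l x"
  have y: "?y \<in> X" "F ?y \<in> X" using resolvent_in F_in assms by auto
  have 1: "d x ?y = (l / (1 + l)) * d x (F ?y)"
    using dist_comb_left[OF x y(2), of "l / (1 + l)"] resolvent_fixpoint[OF assms, symmetric] l by simp
  have 2: "d ?y (F ?y) = (1 - l / (1 + l)) * d x (F ?y)"
    using dist_comb_right[OF x y(2), of "l / (1 + l)"] resolvent_fixpoint[OF assms, symmetric] l by simp
  show 3: "d x (F ?y) = (1 + l) * d ?y (F ?y)"
    unfolding 2 using l by (simp add: field_simps)
  show "d x ?y = l * d ?y (F ?y)"
    unfolding 1 3 using l by (simp add: field_simps)
qed

text \<open>Converse of the preceding distance formulas: they place \<open>y\<close> at the fraction
  \<open>l / (1 + l)\<close> of the way from \<open>x\<close> to \<open>F y\<close>.\<close>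

lemma resolvent_eqI:
  assumes x: "x \<in> X" and l: "l > 0" and y: "y \<in> X"
    and "d x y = l * d y (F y)" "d x (F y) = (1 + l) * d y (F y)"
  shows "J l x = y"
proof -
  have "comb (l / (1 + l)) x (F y) = y"
    by (rule comb_eqI) (use assms F_in in \<open>auto simp: field_simps\<close>)
  then show ?thesis using resolvent_unique[OF x l y] by metis
qed

text \<open>Convexity of the metric bounds the distance of the images by (1 - t)
  \<open>d x x'\<close> plus t times itself; since t < 1, the last term can be absorbed.\<close>

lemma resolvent_nonexpansive:
  assumes x: "x \<in> X" "x' \<in> X" and l: "l > 0"
  shows "d (J l x) (J l x') \<le> d x x'"
proof -
  let ?t = "l / (1 + l)" and ?y = "J l x" and ?y' = "J l x'"
  have t: "0 \<le> ?t" "?t \<le> 1" "?t < 1" using l by auto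
  have y: "?y \<in> X" "?y' \<in> X" using resolvent_in x l by auto
  have "d ?y ?y' \<le> (1 - ?t) * d x x' + ?t * d (F ?y) (F ?y')"
    using dist_comb_le[OF x(1) F_in[OF y(1)] x(2) F_in[OF y(2)] t(1,2)]
      resolvent_fixpoint[OF x(1) l, symmetric] resolvent_fixpoint[OF x(2) l, symmetric] by simp
  also have "\<dots> \<le> (1 - ?t) * d x x' + ?t * d ?y ?y'"
    using mult_left_mono[OF F_le[OF y] t(1)] by simp
  finally have "(1 - ?t) * d ?y ?y' \<le> (1 - ?t) * d x x'" by (simp add: algebra_simps)
  then show ?thesis using t by simp
qed

text \<open>The path from \<open>x\<close> through \<open>F x\<close> to \<open>F (J l x)\<close>
  has length at most \<open>d x (F x)\<close> + l r, while its endpoints are (1 + l) r apart, where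
  r is the new residual.\<close>

lemma resolvent_residual_le:
  assumes x: "x \<in> X" and l: "l > 0"
  shows "d (J l x) (F (J l x)) \<le> d x (F x)"
proof -
  let ?y = "J l x"
  have y: "?y \<in> X" using resolvent_in x l by auto
  have "d x (F ?y) \<le> d x (F x) + d (F x) (F ?y)"
    using x y F_in by (intro triangle) auto
  also have "\<dots> \<le> d x (F x) + d x ?y" using F_le x y by simp
  finally show ?thesis using dist_resolvent[OF x l] dist_resolvent'[OF x l]
    by (simp add: algebra_simps)
qed

lemma dist_resolvent_le:
  assumes "x \<in> X" "l > 0"
  shows "d x (J l x) \<le> l * d x (F x)"
  using resolvent_residual_le[OF assms] assms dist_resolvent[OF assms] by simp

text \<open>The \<open>CAT(0)\<close> inequality seen from \<open>p\<close> contains t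
  \<open>(d p (F ?y))\<^sup>2\<close>, which is at most t \<open>(d p ?y)\<^sup>2\<close> and is
  absorbed on the left. Cancelling 1 - t turns the negative term into the stated gain.\<close>

lemma dist_resolvent_fixed_point:
  assumes x: "x \<in> X" and l: "l > 0" and p: "p \<in> X" "F p = p"
  shows "(d p (J l x))\<^sup>2 \<le> (d p x)\<^sup>2 - l * (1 + l) * (d (J l x) (F (J l x)))\<^sup>2"
proof -
  define t where "t = l / (1 + l)"
  let ?y = "J l x"
  let ?r = "d ?y (F ?y)"
  have t: "0 \<le> t" "t \<le> 1" "t < 1" using l by (auto simp: t_def)
  have y: "?y \<in> X" using resolvent_in x l by auto
  have "d p (F ?y) \<le> d p ?y" using F_le[OF p(1) y] p by simp
  then have 1: "(d p (F ?y))\<^sup>2 \<le> (d p ?y)\<^sup>2" by (simp add: power_mono)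
  have "(d p ?y)\<^sup>2 \<le> (1 - t) * (d p x)\<^sup>2 + t * (d p (F ?y))\<^sup>2 - t * (1 - t) * (d x (F ?y))\<^sup>2"
    using comb_cat0[OF x F_in[OF y] t(1,2) p(1)] resolvent_fixpoint[OF x l, symmetric] by (simp add: t_def)
  also have "\<dots> \<le> (1 - t) * (d p x)\<^sup>2 + t * (d p ?y)\<^sup>2 - t * (1 - t) * (d x (F ?y))\<^sup>2"
    using mult_left_mono[OF 1 t(1)] by simp
  finally have "(1 - t) * (d p ?y)\<^sup>2 \<le> (1 - t) * ((d p x)\<^sup>2 - t * (d x (F ?y))\<^sup>2)"
    by (simp add: algebra_simps)
  then have "(d p ?y)\<^sup>2 \<le> (d p x)\<^sup>2 - t * (d x (F ?y))\<^sup>2"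
    using t mult_le_cancel_left_pos[of "1 - t"] by simp
  also have "t * (d x (F ?y))\<^sup>2 = l * (1 + l) * ?r\<^sup>2"
    unfolding dist_resolvent'[OF x l] t_def using l by (simp add: field_simps power2_eq_square)
  finally show ?thesis .
qed

text \<open>One step of size \<open>l\<close> from \<open>x\<close> is a step of size
  \<open>m\<close> from a point on the segment from \<open>x\<close> to \<open>J l x\<close>. This
  makes steps of different sizes comparable.\<close>

lemma resolvent_identity:
  assumes x: "x \<in> X" and m: "0 < m" "m \<le> l"
  shows "J m (comb (1 - m / l) x (J l x)) = J l x"
proof (rule resolvent_eqI)
  let ?s = "1 - m / l" and ?y = "J l x"
  let ?z = "comb (1 - m / l) x ?y" and ?r = "d ?y (F ?y)"
  have l: "l > 0" using m by simp
  have s: "0 \<le> ?s" "?s \<le> 1" using m by auto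
  show y: "?y \<in> X" using resolvent_in x l by auto
  show z: "?z \<in> X" using comb_in x y s by blast
  show zy: "d ?z ?y = m * ?r"
    using dist_comb_right[OF x y s] dist_resolvent[OF x l] l by simp
  have xz: "d x ?z = (l - m) * ?r"
  proof -
    have "?s * (l * ?r) = (l - m) * ?r" using l by (simp add: field_simps)
    then show ?thesis using dist_comb_left[OF x y s] dist_resolvent[OF x l] by simp
  qed
  \<comment> \<open>The first inequality gives the upper bound. The second gives the lower one,
    because \<open>d x (F ?y)\<close> is (1 + l) r and only (l - m) r of it is spent between
    \<open>x\<close> and \<open>?z\<close>.\<close>
  have "d ?z (F ?y) \<le> d ?z ?y + ?r" "d x (F ?y) \<le> d x ?z + d ?z (F ?y)"
    using x y z F_in by (auto intro: triangle)
  then show "d ?z (F ?y) = (1 + m) * ?r"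
    unfolding zy xz dist_resolvent'[OF x l] by (simp add: algebra_simps)
qed (use m in simp)

section \<open>Iterated resolvents and the comparison of step sizes\<close>

lemma resolvent_iterate_in: "x \<in> X \<Longrightarrow> l > 0 \<Longrightarrow> (J l ^^ n) x \<in> X"
  by (induction n) (auto intro: resolvent_in)

text \<open>Passing through \<open>J l x\<close> and using that \<open>J l\<close> is nonexpansive,
  each further iterate adds at most the length of the first step.\<close>

lemma dist_resolvent_iterate_le:
  assumes x: "x \<in> X" and l: "l > 0"
  shows "d x ((J l ^^ n) x) \<le> n * l * d x (F x)"
proof (induction n)
  case 0
  then show ?case using x by simp
next
  case (Suc n)
  let ?y = "(J l ^^ n) x"
  have y: "?y \<in> X" using resolvent_iterate_in assms by blast
  have "d x (J l ?y) \<le> d x (J l x) + d (J l x) (J l ?y)"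
    using x y l by (intro triangle resolvent_in)
  also have "\<dots> \<le> l * d x (F x) + d x ?y"
    using dist_resolvent_le[OF x l] resolvent_nonexpansive[OF x y l] by simp
  finally show ?case using Suc by (simp add: algebra_simps)
qed

text \<open>The Crandall--Liggett estimate. The right-hand side solves the recursion that the resolvent
  identity and the \<open>CAT(0)\<close> inequality give for the left-hand side: for a step of size
  \<open>\<mu> - l\<close> taken with probability \<open>\<mu> / l\<close> and of size \<open>\<mu>\<close> otherwise, the mean is \<open>0\<close> and the
  variance is \<open>\<mu> (l - \<mu>)\<close>.\<close>

lemma dist_resolvent_iterates:
  assumes x: "x \<in> X" and m: "0 < \<mu>" "\<mu> \<le> l"
  shows "(d ((J \<mu> ^^ m) x) ((J l ^^ n) x))\<^sup>2
          \<le> (d x (F x))\<^sup>2 * ((n * l - m * \<mu>)\<^sup>2 + m * \<mu> * (l - \<mu>))"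
proof -
  define L where "L = d x (F x)"
  have l: "l > 0" using m by simp
  show ?thesis unfolding L_def[symmetric]
  proof (induction m arbitrary: n)
    case 0
    have "(d x ((J l ^^ n) x))\<^sup>2 \<le> (n * l * L)\<^sup>2"
      using dist_resolvent_iterate_le[OF x l] by (simp add: power_mono L_def)
    then show ?case by (simp add: power_mult_distrib mult_ac)
  next
    case IH: (Suc m)
    show ?case
    proof (cases n)
      case 0
      have "(d x ((J \<mu> ^^ Suc m) x))\<^sup>2 \<le> (Suc m * \<mu> * L)\<^sup>2"
        using dist_resolvent_iterate_le[OF x m(1), of "Suc m"] by (simp add: power_mono L_def)
      also have "\<dots> \<le> L\<^sup>2 * ((real 0 * l - Suc m * \<mu>)\<^sup>2 + Suc m * \<mu> * (l - \<mu>))"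
        unfolding power_mult_distrib[of _ L] mult.commute[of _ "L\<^sup>2"]
        by (rule mult_left_mono) (use m in simp_all)
      finally show ?thesis unfolding 0 using commute[of x] by simp
    next
      case (Suc k)
      let ?u = "(J \<mu> ^^ m) x" and ?v = "(J l ^^ k) x" and ?a = "\<mu> / l"
      let ?w = "J l ?v"
      let ?z = "comb (1 - ?a) ?v ?w"
      have u: "?u \<in> X" and v: "?v \<in> X" using resolvent_iterate_in x m l by auto
      have w: "?w \<in> X" using resolvent_in v l by blast
      have a: "0 \<le> 1 - ?a" "1 - ?a \<le> 1" "0 \<le> ?a" using m by auto
      have z: "?z \<in> X" using comb_in v w a by blast
      \<comment> \<open>By the resolvent identity the long step ending in \<open>?w\<close> also
        ends with a step of size \<open>\<mu>\<close>, which can be removed from both sides.\<close>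
      have "d (J \<mu> ?u) ?w = d (J \<mu> ?u) (J \<mu> ?z)"
        using resolvent_identity[OF v m] by simp
      also have "\<dots> \<le> d ?u ?z" by (rule resolvent_nonexpansive[OF u z m(1)])
      finally have "(d (J \<mu> ?u) ?w)\<^sup>2 \<le> (d ?u ?z)\<^sup>2" by (simp add: power_mono)
      also have "\<dots> \<le> ?a * (d ?u ?v)\<^sup>2 + (1 - ?a) * (d ?u ?w)\<^sup>2 - (1 - ?a) * ?a * (d ?v ?w)\<^sup>2"
        using comb_cat0[OF v w a(1,2) u] by simp
      also have "\<dots> \<le> ?a * (d ?u ?v)\<^sup>2 + (1 - ?a) * (d ?u ?w)\<^sup>2"
        using mult_nonneg_nonneg[OF mult_nonneg_nonneg[OF a(1,3)] zero_le_power2[of "d ?v ?w"]]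
        by linarith
      \<comment> \<open>The induction hypothesis enters for \<open>k\<close> and for
        \<open>Suc k\<close>, which is why \<open>n\<close> was left arbitrary.\<close>
      also have "\<dots> \<le> ?a * (L\<^sup>2 * ((k * l - m * \<mu>)\<^sup>2 + m * \<mu> * (l - \<mu>)))
          + (1 - ?a) * (L\<^sup>2 * ((Suc k * l - m * \<mu>)\<^sup>2 + m * \<mu> * (l - \<mu>)))"
        using IH[of k] IH[of "Suc k"] a by (intro add_mono mult_left_mono) auto
      also have "\<dots> = L\<^sup>2 * ((Suc k * l - Suc m * \<mu>)\<^sup>2 + Suc m * \<mu> * (l - \<mu>))"
        using l by (simp add: field_simps power2_eq_square)
      finally show ?thesis unfolding Suc by simp
    qed
  qed
qed

end

section \<open>Existence of the semigroup and its distance to resolvent iterates\<close>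

lemma (in Metric_space) limitin_imp_tendsto_dist:
  assumes "limitin mtopology f z G" "y \<in> M"
  shows "((\<lambda>n. d y (f n)) \<longlongrightarrow> d y z) G"
proof -
  have z: "z \<in> M" and ev: "eventually (\<lambda>n. f n \<in> M) G" and lim: "((\<lambda>n. d (f n) z) \<longlongrightarrow> 0) G"
    using assms(1) by (auto simp: limitin_metric_dist_null)
  have "eventually (\<lambda>n. norm (d y (f n) - d y z) \<le> d (f n) z) G"
    using ev
  proof eventually_elim
    case (elim n)
    have "d y (f n) \<le> d y z + d z (f n)" "d y z \<le> d y (f n) + d (f n) z"
      using z assms(2) elim by (auto intro: triangle)
    then show ?case by (simp add: commute)
  qed
  from this lim have "((\<lambda>n. d y (f n) - d y z) \<longlongrightarrow> 0) G"
    by (rule Lim_null_comparison)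
  then show ?thesis by (simp add: LIM_zero_iff)
qed

context nonexpansive_map
begin

abbreviation T :: "real \<Rightarrow> 'a \<Rightarrow> 'a" where
  "T \<equiv> semigroup_of X d F"

lemma resolvent_scheme_in:
  assumes "x \<in> X" "0 \<le> t"
  shows "(J (t / real n) ^^ n) x \<in> X"
proof (cases "t / real n = 0")
  \<comment> \<open>This covers \<open>t = 0\<close> and also \<open>n = 0\<close>, where division
    by zero gives step size 0.\<close>
  case True
  then have "(J (t / real n) ^^ n) x = x" by (induction n) (auto simp: resolvent_def)
  then show ?thesis using assms by simp
next
  case False
  then show ?thesis using assms by (intro resolvent_iterate_in) auto
qed

text \<open>Taking \<open>m\<close> steps of size \<open>t / m\<close> and \<open>n\<close> steps of
  size \<open>t / n\<close> covers the same total time, so only the variance term of the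
  Crandall--Liggett estimate remains. It is at most \<open>(L * t)\<^sup>2 / n\<close> for n \<le>
  m, so the approximations form a Cauchy sequence.\<close>

lemma limitin_semigroup:
  assumes x: "x \<in> X" and t: "0 \<le> t"
  shows "limitin mtopology (\<lambda>n. (J (t / real n) ^^ n) x) (T t x) sequentially"
proof -
  define \<sigma> where "\<sigma> = (\<lambda>n. (J (t / real n) ^^ n) x)"
  have \<sigma>_in: "\<sigma> n \<in> X" for n using resolvent_scheme_in assms by (simp add: \<sigma>_def)
  define L where "L = d x (F x)"
  have "\<exists>z. limitin mtopology \<sigma> z sequentially"
  proof (cases "t = 0")
    case True
    have "(J 0 ^^ n) x = x" for n by (induction n) (auto simp: resolvent_def)
    then have "\<sigma> = (\<lambda>n. x)" using True by (simp add: \<sigma>_def)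
    then show ?thesis using x by (auto intro!: exI[of _ x] simp: limitin_metric)
  next
    case False
    then have t: "t > 0" using t by simp
    have est: "(d (\<sigma> m) (\<sigma> n))\<^sup>2 \<le> (L * t)\<^sup>2 / n" if "1 \<le> n" "n \<le> m" for m n
    proof -
      have mn: "real n > 0" "real m > 0" using that by auto
      have le: "t / m \<le> t / n" using that t mn by (simp add: field_simps)
      have "(d (\<sigma> m) (\<sigma> n))\<^sup>2 \<le> L\<^sup>2 * ((n * (t / n) - m * (t / m))\<^sup>2 + m * (t / m) * (t / n - t / m))"
        unfolding \<sigma>_def L_def by (rule dist_resolvent_iterates) (use x t le mn in auto)
      also have "\<dots> = L\<^sup>2 * (t * (t / n - t / m))" using mn by simp
      also have "\<dots> \<le> L\<^sup>2 * (t * (t / n))" using t mn by (intro mult_left_mono) auto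
      finally show ?thesis by (simp add: power2_eq_square mult_ac)
    qed
    have "MCauchy \<sigma>" unfolding MCauchy_def
    proof (intro conjI allI impI)
      show "range \<sigma> \<subseteq> X" using \<sigma>_in by auto
      fix \<epsilon> :: real assume e: "\<epsilon> > 0"
      obtain N :: nat where N: "(L * t)\<^sup>2 / \<epsilon>\<^sup>2 < N" using reals_Archimedean2 by blast
      then have N0: "0 < real N" using le_less_trans[of 0] by (meson divide_nonneg_nonneg zero_le_power2)
      have *: "d (\<sigma> m) (\<sigma> n) < \<epsilon>" if "N \<le> n" "n \<le> m" for m n
      proof -
        have "(d (\<sigma> m) (\<sigma> n))\<^sup>2 \<le> (L * t)\<^sup>2 / n" using est that N0 by simp
        also have "\<dots> \<le> (L * t)\<^sup>2 / N" using that N0 by (intro divide_left_mono) auto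
        also have "\<dots> < \<epsilon>\<^sup>2" using N N0 e by (simp add: field_simps)
        finally show ?thesis using e by (simp add: power2_less_imp_less)
      qed
      show "\<exists>N. \<forall>n n'. N \<le> n \<longrightarrow> N \<le> n' \<longrightarrow> d (\<sigma> n) (\<sigma> n') < \<epsilon>"
      proof (intro exI allI impI)
        show "d (\<sigma> m) (\<sigma> n) < \<epsilon>" if "N \<le> m" "N \<le> n" for m n
          using *[of m n] *[of n m] that commute[of "\<sigma> m" "\<sigma> n"] by (cases "n \<le> m") auto
      qed
    qed
    then show ?thesis using mcomplete by (auto simp: mcomplete_def)
  qed
  then obtain z where z: "limitin mtopology \<sigma> z sequentially" by blast
  then have "T t x = z" unfolding semigroup_of_def \<sigma>_def
    by (intro the_equality) (auto dest: limitin_metric_unique)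
  then show ?thesis using z by (simp add: \<sigma>_def)
qed

lemma semigroup_in:
  assumes "x \<in> X" "0 \<le> t" shows "T t x \<in> X"
  using limitin_semigroup[OF assms] limitin_mspace by blast

text \<open>Limit of the Crandall--Liggett estimate when the finer scheme takes \<open>n\<close>
  steps of size \<open>s / n\<close>. That size is at most \<open>l\<close> as soon as
  \<open>n\<close> exceeds \<open>s / l\<close>.\<close>

lemma dist_resolvent_iterate_semigroup:
  assumes x: "x \<in> X" and l: "l > 0" and s: "s > 0"
  shows "(d ((J l ^^ k) x) (T s x))\<^sup>2 \<le> (d x (F x))\<^sup>2 * ((k * l - s)\<^sup>2 + s * l)"
proof (rule tendsto_upperbound)
  let ?y = "(J l ^^ k) x"
  show "(\<lambda>n. (d ?y ((J (s / real n) ^^ n) x))\<^sup>2) \<longlonglongrightarrow> (d ?y (T s x))\<^sup>2"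
    using limitin_semigroup[OF x] s resolvent_iterate_in[OF x l]
    by (intro tendsto_power limitin_imp_tendsto_dist) auto
  obtain N :: nat where N: "s / l < N" using reals_Archimedean2 by blast
  show "\<forall>\<^sub>F n in sequentially. (d ?y ((J (s / real n) ^^ n) x))\<^sup>2
      \<le> (d x (F x))\<^sup>2 * ((k * l - s)\<^sup>2 + s * l)"
    using eventually_ge_at_top[of "max 1 N"]
  proof eventually_elim
    case (elim n)
    then have n: "real n > 0" "s / l < n" using N by auto
    then have le: "s / n \<le> l" using l by (simp add: field_simps)
    have "(d ((J (s / n) ^^ n) x) ?y)\<^sup>2
        \<le> (d x (F x))\<^sup>2 * ((k * l - n * (s / n))\<^sup>2 + n * (s / n) * (l - s / n))"
      by (rule dist_resolvent_iterates) (use x s le n in auto)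
    also have "\<dots> = (d x (F x))\<^sup>2 * ((k * l - s)\<^sup>2 + s * (l - s / n))" using n by simp
    also have "\<dots> \<le> (d x (F x))\<^sup>2 * ((k * l - s)\<^sup>2 + s * l)"
      using s n by (intro mult_left_mono add_left_mono) auto
    finally show ?case by (simp add: commute)
  qed
qed simp

section \<open>Distance to fixed points and decay of the residual\<close>

lemma resolvent_iterate_fixed_point:
  assumes x: "x \<in> X" and l: "l > 0" and p: "p \<in> X" "F p = p"
  shows "(d p ((J l ^^ n) x))\<^sup>2 + n * l * (d ((J l ^^ n) x) (F ((J l ^^ n) x)))\<^sup>2 \<le> (d p x)\<^sup>2"
proof (induction n)
  case 0
  then show ?case by simp
next
  case (Suc n)
  let ?y = "(J l ^^ n) x"
  let ?r = "d ?y (F ?y)" and ?r' = "d (J l ?y) (F (J l ?y))"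
  have y: "?y \<in> X" using resolvent_iterate_in x l by blast
  \<comment> \<open>Residuals do not increase, so the gains of all earlier steps can be measured by
    the newest residual. From the gain \<open>l * (1 + l)\<close> of a step only the part linear in
    \<open>l\<close> is kept; it adds up to the elapsed time \<open>n * l\<close>.\<close>
  have "?r'\<^sup>2 \<le> ?r\<^sup>2"
    using resolvent_residual_le[OF y l] by (simp add: power_mono)
  then have "n * l * ?r'\<^sup>2 \<le> n * l * ?r\<^sup>2" using l by (intro mult_left_mono) auto
  moreover have "(d p (J l ?y))\<^sup>2 \<le> (d p ?y)\<^sup>2 - l * (1 + l) * ?r'\<^sup>2"
    by (rule dist_resolvent_fixed_point[OF y l p])
  moreover have "0 \<le> l * l * ?r'\<^sup>2" by simp
  moreover have "l * (1 + l) * ?r'\<^sup>2 = l * ?r'\<^sup>2 + l * l * ?r'\<^sup>2"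
    "Suc n * l * ?r'\<^sup>2 = l * ?r'\<^sup>2 + n * l * ?r'\<^sup>2" by (simp_all add: algebra_simps)
  ultimately have "(d p (J l ?y))\<^sup>2 + Suc n * l * ?r'\<^sup>2 \<le> (d p x)\<^sup>2" using Suc by linarith
  then show ?case by simp
qed

lemma dist_resolvent_fixed_point_le:
  assumes x: "x \<in> X" and l: "l > 0" and p: "p \<in> X" "F p = p"
  shows "d p (J l x) \<le> d p x"
proof (rule power2_le_imp_le)
  have "0 \<le> l * (1 + l) * (d (J l x) (F (J l x)))\<^sup>2" using l by simp
  then show "(d p (J l x))\<^sup>2 \<le> (d p x)\<^sup>2" using dist_resolvent_fixed_point[OF assms] by linarith
qed simp

lemma resolvent_iterate_fixed_point_antimono:
  assumes x: "x \<in> X" and l: "l > 0" and p: "p \<in> X" "F p = p" and "m \<le> n"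
  shows "d p ((J l ^^ n) x) \<le> d p ((J l ^^ m) x)"
  by (rule lift_Suc_antimono_le[OF _ \<open>m \<le> n\<close>])
    (use dist_resolvent_fixed_point_le resolvent_iterate_in assms in auto)

text \<open>Both times are approximated on a single orbit with step \<open>t / n\<close>: after
  \<open>n\<close> steps for \<open>t\<close>, and after more steps for \<open>s\<close>. Along that
  orbit the distance to \<open>p\<close> does not increase, and the error at time \<open>s\<close>
  vanishes as \<open>n\<close> grows.\<close>

lemma dist_semigroup_fixed_point_antimono:
  assumes x: "x \<in> X" and p: "p \<in> X" "F p = p" and t: "0 < t" "t \<le> s"
  shows "d p (T s x) \<le> d p (T t x)"
proof (rule LIMSEQ_le)
  let ?L = "d x (F x)"
  have s: "s > 0" using t by simp
  show "(\<lambda>n. d p (T s x)) \<longlonglongrightarrow> d p (T s x)" by simp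
  have "(\<lambda>n. t / real n) \<longlonglongrightarrow> 0"
    by (intro tendsto_divide_0[OF tendsto_const] filterlim_at_top_imp_at_infinity filterlim_real_sequentially)
  then have "(\<lambda>n. d p ((J (t / n) ^^ n) x) + sqrt (?L\<^sup>2 * ((t / real n)\<^sup>2 + s * (t / n))))
      \<longlonglongrightarrow> d p (T t x) + sqrt (?L\<^sup>2 * (0\<^sup>2 + s * 0))"
    by (intro tendsto_add limitin_imp_tendsto_dist[OF limitin_semigroup[OF x]] p tendsto_real_sqrt
        tendsto_mult tendsto_power tendsto_const) (use t in simp)
  then show "(\<lambda>n. d p ((J (t / n) ^^ n) x) + sqrt (?L\<^sup>2 * ((t / real n)\<^sup>2 + s * (t / n))))
      \<longlonglongrightarrow> d p (T t x)" by simp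
  show "\<exists>N. \<forall>n\<ge>N. d p (T s x)
      \<le> d p ((J (t / n) ^^ n) x) + sqrt (?L\<^sup>2 * ((t / real n)\<^sup>2 + s * (t / n)))"
  proof (intro exI allI impI)
    fix n :: nat assume n: "n \<ge> 1"
    define l where "l = t / n"
    \<comment> \<open>The number of steps of size \<open>l\<close> that fit into time
      \<open>s\<close>: it misses \<open>s\<close> by at most \<open>l\<close>, and it is at least
      \<open>n\<close> because t \<le> s.\<close>
    define k where "k = nat \<lfloor>s / l\<rfloor>"
    have l: "l > 0" using n t by (simp add: l_def)
    have sl: "s / l \<ge> n" using n t by (simp add: l_def field_simps)
    then have nk: "n \<le> k" unfolding k_def by (simp add: le_nat_iff le_floor_iff)
    have "real k = \<lfloor>s / l\<rfloor>" using s l by (simp add: k_def)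
    then have "real k \<le> s / l" "s / l \<le> real k + 1" by linarith+
    then have "\<bar>k * l - s\<bar> \<le> l" using l by (simp add: field_simps)
    then have "(k * l - s)\<^sup>2 \<le> l\<^sup>2" using abs_le_square_iff[of "k * l - s" l] l by simp
    then have "(d ((J l ^^ k) x) (T s x))\<^sup>2 \<le> ?L\<^sup>2 * (l\<^sup>2 + s * l)"
      using dist_resolvent_iterate_semigroup[OF x l s, of k]
        mult_left_mono[of "(k * l - s)\<^sup>2 + s * l" "l\<^sup>2 + s * l" "?L\<^sup>2"] by simp
    then have 1: "d ((J l ^^ k) x) (T s x) \<le> sqrt (?L\<^sup>2 * (l\<^sup>2 + s * l))"
      by (rule real_le_rsqrt)
    have "d p (T s x) \<le> d p ((J l ^^ k) x) + d ((J l ^^ k) x) (T s x)"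
      using p x l s by (intro triangle resolvent_iterate_in semigroup_in) auto
    also have "\<dots> \<le> d p ((J l ^^ n) x) + sqrt (?L\<^sup>2 * (l\<^sup>2 + s * l))"
      using resolvent_iterate_fixed_point_antimono[OF x l p nk] 1 by simp
    finally show "d p (T s x) \<le> d p ((J (t / n) ^^ n) x) + sqrt (?L\<^sup>2 * ((t / real n)\<^sup>2 + s * (t / n)))"
      unfolding l_def .
  qed
qed

text \<open>For step \<open>t / n\<close> the elapsed time \<open>n * l\<close> is \<open>t\<close>
  for every \<open>n \<ge> 1\<close>, so the bounds for iterates are uniform in \<open>n\<close> and
  pass to the limit.\<close>

lemma semigroup_fixed_point:
  assumes x: "x \<in> X" and p: "p \<in> X" "F p = p" and t: "0 < t"
  shows dist_semigroup_fixed_point_le: "d p (T t x) \<le> d p x"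
    and semigroup_residual_le: "d (T t x) (F (T t x)) \<le> d p x / sqrt t"
proof -
  define \<sigma> where "\<sigma> = (\<lambda>n. (J (t / real n) ^^ n) x)"
  let ?z = "T t x"
  have z: "?z \<in> X" using semigroup_in x t by simp
  have lim: "limitin mtopology \<sigma> ?z sequentially"
    using limitin_semigroup[OF x] t by (simp add: \<sigma>_def)
  have \<sigma>: "\<sigma> n \<in> X" for n using resolvent_scheme_in x t by (simp add: \<sigma>_def)
  have bounds: "d p (\<sigma> n) \<le> d p x" "d (\<sigma> n) (F (\<sigma> n)) \<le> d p x / sqrt t" if "n \<ge> 1" for n
  proof -
    have l: "t / n > 0" using that t by simp
    have *: "(d p (\<sigma> n))\<^sup>2 + t * (d (\<sigma> n) (F (\<sigma> n)))\<^sup>2 \<le> (d p x)\<^sup>2"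
      using resolvent_iterate_fixed_point[OF x l p, of n] that by (simp add: \<sigma>_def)
    moreover have "0 \<le> t * (d (\<sigma> n) (F (\<sigma> n)))\<^sup>2" using t by simp
    ultimately have "(d p (\<sigma> n))\<^sup>2 \<le> (d p x)\<^sup>2" by linarith
    then show "d p (\<sigma> n) \<le> d p x" by (rule power2_le_imp_le) simp
    have "(d (\<sigma> n) (F (\<sigma> n)) * sqrt t)\<^sup>2 \<le> (d p x)\<^sup>2"
    proof -
      have "(d (\<sigma> n) (F (\<sigma> n)) * sqrt t)\<^sup>2 = t * (d (\<sigma> n) (F (\<sigma> n)))\<^sup>2"
        using t by (simp add: power_mult_distrib)
      then show ?thesis using * zero_le_power2[of "d p (\<sigma> n)"] by linarith
    qed
    then have "d (\<sigma> n) (F (\<sigma> n)) * sqrt t \<le> d p x" by (rule power2_le_imp_le) simp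
    then show "d (\<sigma> n) (F (\<sigma> n)) \<le> d p x / sqrt t" using t by (simp add: field_simps)
  qed
  show "d p ?z \<le> d p x"
  proof (rule tendsto_upperbound[OF limitin_imp_tendsto_dist[OF lim p(1)]])
    show "\<forall>\<^sub>F n in sequentially. d p (\<sigma> n) \<le> d p x"
      using eventually_ge_at_top[of 1] by eventually_elim (rule bounds(1))
  qed simp
  \<comment> \<open>Replacing \<open>\<sigma> n\<close> by \<open>?z\<close> changes the residual by
    at most twice their distance: once for the point and once for its image under
    \<open>F\<close>.\<close>
  have "(\<lambda>n. 2 * d ?z (\<sigma> n) + d p x / sqrt t) \<longlonglongrightarrow> 2 * d ?z ?z + d p x / sqrt t"
    by (intro tendsto_add tendsto_mult tendsto_const limitin_imp_tendsto_dist lim z)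
  then have "(\<lambda>n. 2 * d ?z (\<sigma> n) + d p x / sqrt t) \<longlonglongrightarrow> d p x / sqrt t" using z by simp
  then show "d ?z (F ?z) \<le> d p x / sqrt t"
  proof (rule tendsto_lowerbound)
    show "\<forall>\<^sub>F n in sequentially. d ?z (F ?z) \<le> 2 * d ?z (\<sigma> n) + d p x / sqrt t"
      using eventually_ge_at_top[of 1]
    proof eventually_elim
      case (elim n)
      have "d ?z (F ?z) \<le> d ?z (\<sigma> n) + d (\<sigma> n) (F ?z)"
        "d (\<sigma> n) (F ?z) \<le> d (\<sigma> n) (F (\<sigma> n)) + d (F (\<sigma> n)) (F ?z)"
        by (intro triangle z \<sigma> F_in)+
      then show ?case using bounds(2)[OF elim] F_le[OF \<sigma> z, of n] commute[of "\<sigma> n" ?z] by linarith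
    qed
  qed simp
qed

end

section \<open>Convergence of monotone real functions\<close>

lemma decreasing_imp_convergent:
  fixes f :: "nat \<Rightarrow> real"
  assumes "\<And>n. f (Suc n) \<le> f n" "\<And>n. 0 \<le> f n"
  shows "\<exists>a. f \<longlonglongrightarrow> a"
  using assms decseq_SucI decseq_convergent by metis

lemma decreasing_bounded_convergent_at_top:
  fixes f :: "real \<Rightarrow> real"
  assumes anti: "\<And>s t. s \<le> t \<Longrightarrow> f t \<le> f s" and nonneg: "\<And>t. 0 \<le> f t"
  shows "\<exists>a. (f \<longlongrightarrow> a) at_top"
proof
  have bdd: "bdd_below (range f)" using nonneg by (intro bdd_belowI[of _ 0]) auto
  show "(f \<longlongrightarrow> Inf (range f)) at_top"
  proof (rule decreasing_tendsto)
    show "\<forall>\<^sub>F t in at_top. Inf (range f) \<le> f t"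
      by (intro always_eventually allI cInf_lower bdd rangeI)
    fix y assume "Inf (range f) < y"
    then obtain s where s: "f s < y"
      using cInf_lessD[of "range f" y] by blast
    show "\<forall>\<^sub>F t in at_top. f t < y"
      using eventually_ge_at_top[of s]
      by eventually_elim (rule order.strict_trans1[OF anti s])
  qed
qed

section \<open>Asymptotic centers of bounded sequences\<close>

context hadamard
begin

text \<open>The squared asymptotic radius of \<open>s\<close> about \<open>x\<close>; an asymptotic
  center is its strict minimizer.\<close>

abbreviation radius2 :: "(nat \<Rightarrow> 'b) \<Rightarrow> 'b \<Rightarrow> ereal" where
  "radius2 s x \<equiv> limsup (\<lambda>n. ereal ((d x (s n))\<^sup>2))"

lemma radius2_finite:
  assumes s: "mbounded (range s)" and x: "x \<in> X"
  obtains r where "r \<ge> 0" "radius2 s x = ereal r"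
proof -
  obtain a B where a: "a \<in> X" "\<And>n. s n \<in> X" "\<And>n. d a (s n) \<le> B"
    using s by (auto simp: mbounded)
  have "d x (s n) \<le> d x a + B" for n
    using triangle[OF x a(1) a(2)[of n]] a(3)[of n] by linarith
  then have "(d x (s n))\<^sup>2 \<le> (d x a + B)\<^sup>2" for n
    by (intro power_mono) auto
  then have "radius2 s x \<le> ereal ((d x a + B)\<^sup>2)"
    by (intro Limsup_bounded) auto
  moreover have "0 \<le> radius2 s x"
    by (rule le_Limsup) auto
  ultimately show ?thesis using that by (cases "radius2 s x") auto
qed

lemma radius2_eventually_less:
  assumes "radius2 s x = ereal r" "r < r'"
  shows "eventually (\<lambda>n. (d x (s n))\<^sup>2 < r') sequentially"
  using Limsup_lessD[of sequentially "\<lambda>n. ereal ((d x (s n))\<^sup>2)" "ereal r'"] assms by simp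

lemma radius2_le:
  assumes "\<And>\<epsilon>. \<epsilon> > 0 \<Longrightarrow> eventually (\<lambda>n. (d x (s n))\<^sup>2 \<le> B + \<epsilon>) sequentially"
  shows "radius2 s x \<le> ereal B"
proof (rule ereal_le_epsilon2)
  fix \<epsilon> :: real assume "\<epsilon> > 0"
  then have "eventually (\<lambda>n. ereal ((d x (s n))\<^sup>2) \<le> ereal (B + \<epsilon>)) sequentially"
    using assms by simp
  then show "radius2 s x \<le> ereal B + ereal \<epsilon>"
    by (simp add: Limsup_bounded)
qed

text \<open>The \<open>CAT(0)\<close> inequality at t = 1/2 holds for every \<open>n\<close> and
  survives the limit superior. This uniform convexity yields both existence and uniqueness of the
  minimizer.\<close>

lemma radius2_midpoint:
  assumes s: "range s \<subseteq> X" and "x \<in> X" "y \<in> X"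
    and r: "radius2 s x = ereal r" "radius2 s y = ereal r'"
  shows "radius2 s (comb (1/2) x y) \<le> ereal ((r + r') / 2 - (d x y)\<^sup>2 / 4)"
proof (rule radius2_le)
  fix \<epsilon> :: real assume "\<epsilon> > 0"
  then have "eventually (\<lambda>n. (d x (s n))\<^sup>2 < r + \<epsilon>) sequentially"
    "eventually (\<lambda>n. (d y (s n))\<^sup>2 < r' + \<epsilon>) sequentially"
    using radius2_eventually_less r by auto
  then show "eventually (\<lambda>n. (d (comb (1/2) x y) (s n))\<^sup>2 \<le> (r + r') / 2 - (d x y)\<^sup>2 / 4 + \<epsilon>) sequentially"
  proof eventually_elim
    case (elim n)
    have "(d (s n) (comb (1/2) x y))\<^sup>2
      \<le> (1 - 1/2) * (d (s n) x)\<^sup>2 + 1/2 * (d (s n) y)\<^sup>2 - 1/2 * (1 - 1/2) * (d x y)\<^sup>2"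
      by (rule comb_cat0) (use assms in auto)
    then have "(d (comb (1/2) x y) (s n))\<^sup>2
        \<le> (d x (s n))\<^sup>2 / 2 + (d y (s n))\<^sup>2 / 2 - (d x y)\<^sup>2 / 4"
      by (simp add: commute[of "s n"])
    then show ?case using elim by argo
  qed
qed

lemma asymptotic_center_exists:
  assumes s: "mbounded (range s)"
  shows "\<exists>c. is_asymptotic_center X d s c"
proof -
  have sX: "range s \<subseteq> X" using s by (rule mbounded_subset_mspace)
  define r where "r x = real_of_ereal (radius2 s x)" for x
  have r: "radius2 s x = ereal (r x)" "r x \<ge> 0" if "x \<in> X" for x
    using radius2_finite[OF s that] by (metis r_def real_of_ereal.simps(1))+
  define I where "I = Inf (r ` X)"
  have ne: "X \<noteq> {}" using sX by auto
  have bdd: "bdd_below (r ` X)" using r by (auto intro!: bdd_belowI[of _ 0])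
  have I_le: "I \<le> r x" if "x \<in> X" for x
    unfolding I_def using bdd that by (intro cInf_lower) auto
  \<comment> \<open>Near-minimizers are close to each other, since the midpoint cannot have a value
    below the infimum \<open>I\<close>.\<close>
  have mid: "(d x y)\<^sup>2 \<le> 2 * (r x - I) + 2 * (r y - I)" if "x \<in> X" "y \<in> X" for x y
  proof -
    have m: "comb (1/2) x y \<in> X" using that by (intro comb_in) auto
    have "r (comb (1/2) x y) \<le> (r x + r y) / 2 - (d x y)\<^sup>2 / 4"
      using radius2_midpoint[OF sX that r(1)[OF that(1)] r(1)[OF that(2)]] r(1)[OF m] by simp
    then show ?thesis using I_le[OF m] by (simp add: field_simps)
  qed
  have "\<exists>x\<in>X. r x < I + 1 / Suc k" for k
    using cInf_lessD[of "r ` X" "I + 1 / Suc k"] ne by (auto simp: I_def)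
  then obtain x where x: "\<And>k. x k \<in> X" "\<And>k. r (x k) < I + 1 / Suc k" by metis
  have "MCauchy x" unfolding MCauchy_def
  proof (intro conjI allI impI)
    show "range x \<subseteq> X" using x by auto
    fix \<epsilon> :: real assume e: "\<epsilon> > 0"
    \<comment> \<open>Two points whose excess over \<open>I\<close> is below a quarter of
      \<open>\<epsilon>\<^sup>2\<close> are less than \<open>\<epsilon>\<close> apart by
      \<open>mid\<close>.\<close>
    obtain N where N: "1 / Suc N < \<epsilon>\<^sup>2 / 4"
      using e nat_approx_posE[of "\<epsilon>\<^sup>2 / 4"] by auto
    have xN: "r (x k) < I + \<epsilon>\<^sup>2 / 4" if "N \<le> k" for k
    proof -
      have "1 / real (Suc k) \<le> 1 / real (Suc N)" using that by (intro divide_left_mono) auto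
      then have "1 / real (Suc k) < \<epsilon>\<^sup>2 / 4" using N by (rule order.strict_trans1)
      then show ?thesis by (rule order.strict_trans[OF x(2) add_strict_left_mono])
    qed
    have "d (x m) (x n) < \<epsilon>" if "N \<le> m" "N \<le> n" for m n
    proof (rule power2_less_imp_less)
      show "(d (x m) (x n))\<^sup>2 < \<epsilon>\<^sup>2"
        using mid[OF x(1) x(1), of m n] xN[OF that(1)] xN[OF that(2)] by argo
      show "0 \<le> \<epsilon>" using e by simp
    qed
    then show "\<exists>N. \<forall>n n'. N \<le> n \<longrightarrow> N \<le> n' \<longrightarrow> d (x n) (x n') < \<epsilon>" by blast
  qed
  then obtain c where c: "limitin mtopology x c sequentially"
    using mcomplete by (auto simp: mcomplete_def)
  have cX: "c \<in> X" using c limitin_mspace by blast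
  obtain K where K: "K \<ge> 0" "\<And>n. d c (s n) \<le> K"
  proof -
    obtain a B where a: "a \<in> X" "\<And>n. s n \<in> X" "\<And>n. d a (s n) \<le> B"
      using s by (auto simp: mbounded)
    have *: "d c (s n) \<le> d c a + B" for n
      using triangle[OF cX a(1) a(2)[of n]] a(3)[of n] by linarith
    have "0 \<le> d c (s 0)" by simp
    also have "\<dots> \<le> d c a + B" by (rule *)
    finally show ?thesis using that * by blast
  qed
  \<comment> \<open>Continuity of the radius: a difference of squares is factored, with the
    difference of the distances at most \<open>d c (x k)\<close> and their sum at most
    \<open>2 * K + d c (x k)\<close>.\<close>
  have rc: "r c \<le> r (x k) + d c (x k) * (2 * K + d c (x k))" for k
  proof -
    let ?e = "d c (x k)"
    have "radius2 s c \<le> ereal (r (x k) + ?e * (2 * K + ?e))"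
    proof (rule radius2_le)
      fix \<epsilon> :: real assume "\<epsilon> > 0"
      then have "eventually (\<lambda>n. (d (x k) (s n))\<^sup>2 < r (x k) + \<epsilon>) sequentially"
        using radius2_eventually_less r(1)[OF x(1)] by simp
      then show "eventually (\<lambda>n. (d c (s n))\<^sup>2 \<le> r (x k) + ?e * (2 * K + ?e) + \<epsilon>) sequentially"
      proof eventually_elim
        case (elim n)
        have sn: "s n \<in> X" using sX by auto
        have 1: "d c (s n) \<le> ?e + d (x k) (s n)" using cX x sn by (intro triangle)
        have 2: "d (x k) (s n) \<le> ?e + d c (s n)"
          using triangle[OF x(1) cX sn, of k] by (simp add: commute[of c])
        have "(d c (s n))\<^sup>2 - (d (x k) (s n))\<^sup>2
            = (d c (s n) - d (x k) (s n)) * (d c (s n) + d (x k) (s n))"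
          by (simp add: power2_eq_square algebra_simps)
        also have "\<dots> \<le> ?e * (d c (s n) + d (x k) (s n))"
          using 1 by (intro mult_right_mono) auto
        also have "\<dots> \<le> ?e * (2 * K + ?e)"
          using 2 K(2)[of n] by (intro mult_left_mono) auto
        finally show ?case using elim by simp
      qed
    qed
    then show ?thesis using r(1)[OF cX] by simp
  qed
  have "(\<lambda>k. d c (x k)) \<longlonglongrightarrow> 0"
    using limitin_imp_tendsto_dist[OF c cX] cX by simp
  then have "(\<lambda>k. (I + 1 / Suc k) + d c (x k) * (2 * K + d c (x k))) \<longlonglongrightarrow> (I + 0) + 0 * (2 * K + 0)"
    by (intro tendsto_intros LIMSEQ_Suc[OF lim_1_over_n])
  moreover have "r c \<le> (I + 1 / Suc k) + d c (x k) * (2 * K + d c (x k))" for k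
    using rc[of k] x(2)[of k] by simp
  ultimately have rcI: "r c \<le> I" by (auto intro: tendsto_lowerbound)
  \<comment> \<open>Since \<open>r c\<close> attains the infimum, \<open>mid\<close> applied to
    \<open>c\<close> and \<open>y\<close> forces a positive excess at \<open>y\<close>.\<close>
  have "r c < r y" if "y \<in> X" "y \<noteq> c" for y
  proof -
    have "0 < (d c y)\<^sup>2" using that cX by auto
    then show ?thesis using mid[OF cX that(1)] rcI by argo
  qed
  then show ?thesis using cX r by (auto simp: is_asymptotic_center_def)
qed

text \<open>When the distances converge, the limits superior are squares of limits, and strict
  minimality becomes an inequality between real numbers.\<close>

lemma asymptotic_center_tendsto_less:
  assumes "is_asymptotic_center X d s c" "x \<in> X" "x \<noteq> c"
    and "(\<lambda>n. d c (s n)) \<longlonglongrightarrow> a" "(\<lambda>n. d x (s n)) \<longlonglongrightarrow> b"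
  shows "a\<^sup>2 < b\<^sup>2"
proof -
  have "radius2 s c = ereal (a\<^sup>2)" "radius2 s x = ereal (b\<^sup>2)"
    using assms(4,5) by (auto intro!: lim_imp_Limsup tendsto_intros)
  then show ?thesis using assms by (auto simp: is_asymptotic_center_def)
qed

end

section \<open>Weak convergence of the two flows\<close>

context nonexpansive_map
begin

text \<open>The distance from \<open>F c\<close> to \<open>s n\<close> exceeds that from
  \<open>c\<close> by at most the residual of \<open>s n\<close>, which vanishes. So the radius
  about \<open>F c\<close> is no larger than about \<open>c\<close>, contradicting strict minimality
  unless they coincide.\<close>

lemma asymptotic_center_fixed_point:
  assumes c: "is_asymptotic_center X d s c" and s: "mbounded (range s)"
    and res: "(\<lambda>n. d (s n) (F (s n))) \<longlonglongrightarrow> 0"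
  shows "F c = c"
proof (rule ccontr)
  assume neq: "F c \<noteq> c"
  have cX: "c \<in> X" using c by (simp add: is_asymptotic_center_def)
  have sX: "s n \<in> X" for n using mbounded_subset_mspace[OF s] by auto
  obtain r where r: "r \<ge> 0" "radius2 s c = ereal r" using radius2_finite[OF s cX] .
  have "radius2 s (F c) \<le> ereal r"
  proof (rule radius2_le)
    fix \<epsilon> :: real assume e: "\<epsilon> > 0"
    \<comment> \<open>Half of \<open>\<epsilon>\<close> is spent on the limit superior;
      \<open>\<eta>\<close> is the room this leaves for the residual.\<close>
    define \<rho> where "\<rho> = sqrt (r + \<epsilon> / 2)"
    define \<eta> where "\<eta> = sqrt (r + \<epsilon>) - \<rho>"
    have "\<eta> > 0" using e by (simp add: \<eta>_def \<rho>_def)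
    then have "eventually (\<lambda>n. d (s n) (F (s n)) < \<eta>) sequentially"
      using res by (intro order_tendstoD) auto
    moreover have "eventually (\<lambda>n. (d c (s n))\<^sup>2 < r + \<epsilon> / 2) sequentially"
      using radius2_eventually_less[OF r(2)] e by simp
    ultimately show "eventually (\<lambda>n. (d (F c) (s n))\<^sup>2 \<le> r + \<epsilon>) sequentially"
    proof eventually_elim
      case (elim n)
      have "d (F c) (s n) \<le> d (F c) (F (s n)) + d (F (s n)) (s n)"
        using cX sX F_in by (intro triangle) auto
      moreover have "d (F c) (F (s n)) \<le> d c (s n)" using F_le cX sX by blast
      moreover have "d c (s n) \<le> \<rho>"
        unfolding \<rho>_def using elim(2) by (intro real_le_rsqrt) simp
      ultimately have "d (F c) (s n) \<le> sqrt (r + \<epsilon>)"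
        using elim(1) by (simp add: \<eta>_def commute)
      then have "(d (F c) (s n))\<^sup>2 \<le> (sqrt (r + \<epsilon>))\<^sup>2" by (simp add: power_mono)
      then show ?case using r(1) e by simp
    qed
  qed
  moreover have "radius2 s c < radius2 s (F c)"
    using c neq F_in[OF cX] by (auto simp: is_asymptotic_center_def)
  ultimately show False using r by simp
qed

text \<open>Opial's argument, along an arbitrary filter: the asymptotic center of any sequence of points
  \<open>u i\<close> with \<open>i\<close> tending along \<open>G\<close> is a fixed point, and two fixed points that are asymptotic
  centers would each have to be strictly closer to \<open>u\<close> in the limit than the other.\<close>

lemma weakly_converges_fixed_point:
  fixes u :: "'i \<Rightarrow> 'a"
  assumes bounded: "mbounded (u ` I)"
    and res: "((\<lambda>i. d (u i) (F (u i))) \<longlongrightarrow> 0) G"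
    and dist: "\<And>p. p \<in> X \<Longrightarrow> F p = p \<Longrightarrow> \<exists>a. ((\<lambda>i. d p (u i)) \<longlongrightarrow> a) G"
    and \<tau>0: "filterlim \<tau>0 G sequentially" "range \<tau>0 \<subseteq> I"
  obtains g where "g \<in> X" "F g = g"
    "\<And>\<tau>. filterlim \<tau> G sequentially \<Longrightarrow> range \<tau> \<subseteq> I \<Longrightarrow> weakly_converges X d (\<lambda>n. u (\<tau> n)) g"
proof -
  have bdd: "mbounded (range (\<lambda>n. u (\<tau> n)))" if "range \<tau> \<subseteq> I" for \<tau> :: "nat \<Rightarrow> 'i"
    by (rule mbounded_subset[OF bounded]) (use that in auto)
  have fixed: "c \<in> X \<and> F c = c"
    if "filterlim \<tau> G sequentially" "range \<tau> \<subseteq> I" "is_asymptotic_center X d (\<lambda>n. u (\<tau> n)) c"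
    for \<tau> c
    using asymptotic_center_fixed_point[OF that(3) bdd[OF that(2)]]
      filterlim_compose[OF res that(1)] that(3) by (auto simp: is_asymptotic_center_def)
  obtain g where g: "is_asymptotic_center X d (\<lambda>n. u (\<tau>0 n)) g"
    using asymptotic_center_exists bdd \<tau>0 by blast
  have gF: "g \<in> X" "F g = g" using fixed[OF \<tau>0 g] by auto
  obtain a where a: "((\<lambda>i. d g (u i)) \<longlongrightarrow> a) G" using dist gF by blast
  have center: "is_asymptotic_center X d (\<lambda>n. u (\<tau> n)) g"
    if \<tau>: "filterlim \<tau> G sequentially" "range \<tau> \<subseteq> I" for \<tau>
  proof -
    obtain c where c: "is_asymptotic_center X d (\<lambda>n. u (\<tau> n)) c"
      using asymptotic_center_exists bdd \<tau> by blast
    have cF: "c \<in> X" "F c = c" using fixed[OF \<tau> c] by auto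
    obtain b where b: "((\<lambda>i. d c (u i)) \<longlongrightarrow> b) G" using dist cF by blast
    have "c = g"
    proof (rule ccontr)
      assume "c \<noteq> g"
      \<comment> \<open>The limits \<open>a\<close> and \<open>b\<close> are taken along
        \<open>G\<close>, hence are the same along \<open>\<tau>0\<close> and \<open>\<tau>\<close>;
        minimality of \<open>g\<close> for one sequence and of \<open>c\<close> for the other then
        conflict.\<close>
      then have "a\<^sup>2 < b\<^sup>2" "b\<^sup>2 < a\<^sup>2"
        using asymptotic_center_tendsto_less[OF g cF(1) _ filterlim_compose[OF a \<tau>0(1)]
            filterlim_compose[OF b \<tau>0(1)]]
          asymptotic_center_tendsto_less[OF c gF(1) _ filterlim_compose[OF b \<tau>(1)]
            filterlim_compose[OF a \<tau>(1)]] by auto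
      then show False by simp
    qed
    then show ?thesis using c by simp
  qed
  have "weakly_converges X d (\<lambda>n. u (\<tau> n)) g"
    if \<tau>: "filterlim \<tau> G sequentially" "range \<tau> \<subseteq> I" for \<tau>
    unfolding weakly_converges_def
  proof (intro conjI allI impI)
    show "mbounded (range (\<lambda>n. u (\<tau> n)))" using bdd \<tau> by blast
    fix r :: "nat \<Rightarrow> nat" assume "strict_mono r"
    then have "filterlim (\<tau> \<circ> r) G sequentially"
      unfolding comp_def by (rule filterlim_compose[OF \<tau>(1) filterlim_subseq])
    then have "is_asymptotic_center X d (\<lambda>n. u ((\<tau> \<circ> r) n)) g"
      by (rule center) (use \<tau> in auto)
    then show "is_asymptotic_center X d ((\<lambda>n. u (\<tau> n)) \<circ> r) g" by (simp add: comp_def)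
  qed
  then show ?thesis using that gF by blast
qed

text \<open>Telescoping the fixed point inequality with nonincreasing residuals bounds the partial
  sum of squared step sizes times the squared residual. Divergence of the sum then forces the
  residual to 0.\<close>

lemma resolvent_sequence_weakly_converges:
  assumes ex_fixed: "\<exists>p\<in>X. F p = p"
    and lam: "\<And>n. n \<ge> 1 \<Longrightarrow> 0 < lam n" and div: "(\<Sum>n. ennreal ((lam (Suc n))\<^sup>2)) = \<infinity>"
    and f0: "f 0 \<in> X" and f: "\<And>n. n \<ge> 1 \<Longrightarrow> f n = J (lam n) (f (n - 1))"
  shows "\<exists>g\<in>X. weakly_converges X d f g \<and> F g = g"
proof -
  \<comment> \<open>Step sizes are constrained from index 1 on; shifting by \<open>Suc\<close> makes
    the recursion start at \<open>f 0\<close>.\<close>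
  have lS: "0 < lam (Suc n)" and fS: "f (Suc n) = J (lam (Suc n)) (f n)" for n
    using lam f[of "Suc n"] by auto
  have fX: "f n \<in> X" for n by (induction n) (auto simp: f0 fS lS intro: resolvent_in)
  define \<rho> where "\<rho> n = d (f n) (F (f n))" for n
  have \<rho>_dec: "\<rho> (Suc n) \<le> \<rho> n" for n
    using resolvent_residual_le[OF fX lS] by (simp add: \<rho>_def fS)
  have p_dec: "d p (f (Suc n)) \<le> d p (f n)" if "p \<in> X" "F p = p" for p n
    using dist_resolvent_fixed_point_le[OF fX lS that] by (simp add: fS)
  obtain p where p: "p \<in> X" "F p = p" using ex_fixed by blast
  define D where "D = (d p (f 0))\<^sup>2"
  have sum_le: "(d p (f n))\<^sup>2 + (\<Sum>k<n. (lam (Suc k))\<^sup>2) * (\<rho> n)\<^sup>2 \<le> D" for n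
  proof (induction n)
    case 0
    then show ?case by (simp add: D_def)
  next
    case (Suc n)
    let ?l = "lam (Suc n)" and ?S = "\<Sum>k<n. (lam (Suc k))\<^sup>2"
    have "(d p (f (Suc n)))\<^sup>2 \<le> (d p (f n))\<^sup>2 - ?l * (1 + ?l) * (\<rho> (Suc n))\<^sup>2"
      using dist_resolvent_fixed_point[OF fX lS p] by (simp add: \<rho>_def fS)
    moreover have "?l * (1 + ?l) * (\<rho> (Suc n))\<^sup>2 = ?l\<^sup>2 * (\<rho> (Suc n))\<^sup>2 + ?l * (\<rho> (Suc n))\<^sup>2"
      by (simp add: algebra_simps power2_eq_square)
    \<comment> \<open>Of the gain \<open>?l * (1 + ?l)\<close> the linear part is dropped, as
      divergence is assumed for the squares.\<close>
    moreover have "0 \<le> ?l * (\<rho> (Suc n))\<^sup>2" using lS[of n] by simp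
    moreover have "?S * (\<rho> (Suc n))\<^sup>2 \<le> ?S * (\<rho> n)\<^sup>2"
      using \<rho>_dec[of n] by (intro mult_left_mono power_mono sum_nonneg) (auto simp: \<rho>_def)
    moreover have "(\<Sum>k<Suc n. (lam (Suc k))\<^sup>2) * (\<rho> (Suc n))\<^sup>2 = ?S * (\<rho> (Suc n))\<^sup>2 + ?l\<^sup>2 * (\<rho> (Suc n))\<^sup>2"
      by (simp add: algebra_simps)
    ultimately show ?case using Suc by linarith
  qed
  obtain a where a: "\<rho> \<longlonglongrightarrow> a" using decreasing_imp_convergent[of \<rho>] \<rho>_dec by (auto simp: \<rho>_def)
  have a_le: "a \<le> \<rho> n" for n
    using decseq_ge[OF decseq_SucI[of \<rho>] a] \<rho>_dec by simp
  have a0: "a \<ge> 0" by (rule tendsto_lowerbound[OF a]) (auto simp: \<rho>_def)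
  have "a = 0"
  proof (rule ccontr)
    assume "a \<noteq> 0"
    then have a: "a > 0" using a0 by simp
    \<comment> \<open>A positive limit \<open>a\<close> is a lower bound for all residuals and would
      bound the divergent partial sums.\<close>
    have "(\<Sum>k<n. (lam (Suc k))\<^sup>2) \<le> D / a\<^sup>2" for n
    proof -
      have "(\<Sum>k<n. (lam (Suc k))\<^sup>2) * a\<^sup>2 \<le> (\<Sum>k<n. (lam (Suc k))\<^sup>2) * (\<rho> n)\<^sup>2"
        using a a_le by (intro mult_left_mono power_mono sum_nonneg) auto
      also have "\<dots> \<le> D" using sum_le[of n] zero_le_power2[of "d p (f n)"] by linarith
      finally show ?thesis using a by (simp add: field_simps)
    qed
    then have "(\<Sum>k<n. ennreal ((lam (Suc k))\<^sup>2)) \<le> ennreal (D / a\<^sup>2)" for n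
      by (simp add: sum_ennreal ennreal_leI)
    then have "(\<Sum>n. ennreal ((lam (Suc n))\<^sup>2)) \<le> ennreal (D / a\<^sup>2)"
      by (intro suminf_le_const) auto
    then show False using div by (metis ennreal_neq_top infinity_ennreal_def top_unique)
  qed
  then have res: "(\<lambda>n. d (f n) (F (f n))) \<longlonglongrightarrow> 0" using a by (simp add: \<rho>_def[abs_def])
  have "d p (f n) \<le> d p (f 0)" for n
    by (rule lift_Suc_antimono_le[of "\<lambda>n. d p (f n)"]) (use p_dec p in auto)
  then have bdd: "mbounded (range f)"
    using p fX by (auto simp: mbounded)
  show ?thesis
  proof (rule weakly_converges_fixed_point[OF bdd res])
    show "\<exists>a. (\<lambda>n. d q (f n)) \<longlonglongrightarrow> a" if "q \<in> X" "F q = q" for q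
      by (rule decreasing_imp_convergent) (use p_dec that in auto)
    show "filterlim (\<lambda>n. n) sequentially sequentially" by (rule filterlim_ident)
    show ?thesis
      if "g \<in> X" "F g = g"
        "\<And>\<tau>. filterlim \<tau> sequentially sequentially \<Longrightarrow> range \<tau> \<subseteq> UNIV \<Longrightarrow> weakly_converges X d (\<lambda>n. f (\<tau> n)) g"
      for g
      using that(1,2) that(3)[of "\<lambda>n. n"] by (auto simp: filterlim_ident)
  qed auto
qed

text \<open>Opial's argument along \<open>at_top\<close>: the residual is at most
  \<open>d p x / sqrt t\<close>, and the distance to each fixed point is nonincreasing in positive
  time, hence convergent.\<close>

lemma semigroup_weakly_converges:
  assumes ex_fixed: "\<exists>p\<in>X. F p = p" and x: "x \<in> X"
  shows "\<exists>g\<in>X. weakly_converges_at_top X d (\<lambda>t. T t x) g \<and> F g = g"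
proof -
  obtain p where p: "p \<in> X" "F p = p" using ex_fixed by blast
  have Tx: "T t x \<in> X" if "t \<ge> 0" for t using semigroup_in x that .
  \<comment> \<open>The distance bound was proved for positive times, so time 0 enters the maximum
    separately.\<close>
  let ?B = "max (d p x) (d p (T 0 x))"
  have le: "d p (T t x) \<le> ?B" if "t \<ge> 0" for t
    using dist_semigroup_fixed_point_le[OF x p, of t] that by (cases "t = 0") auto
  have bdd: "mbounded ((\<lambda>t. T t x) ` {0..})"
    unfolding mbounded
  proof (intro disjI2 conjI exI[of _ p] exI[of _ ?B] ballI)
    show "y \<in> X" "d p y \<le> ?B" if "y \<in> (\<lambda>t. T t x) ` {0..}" for y
      using that Tx le by auto
  qed (rule p)
  have res: "((\<lambda>t. d (T t x) (F (T t x))) \<longlongrightarrow> 0) at_top"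
  proof (rule Lim_null_comparison)
    show "((\<lambda>t. d p x / sqrt t) \<longlongrightarrow> 0) at_top"
      by (intro tendsto_divide_0[OF tendsto_const] filterlim_at_top_imp_at_infinity sqrt_at_top)
    show "\<forall>\<^sub>F t in at_top. norm (d (T t x) (F (T t x))) \<le> d p x / sqrt t"
      using eventually_gt_at_top[of 0]
    proof eventually_elim
      case (elim t)
      then show ?case using semigroup_residual_le[OF x p elim] by simp
    qed
  qed
  have dist: "\<exists>a. ((\<lambda>t. d q (T t x)) \<longlongrightarrow> a) at_top" if q: "q \<in> X" "F q = q" for q
  proof -
    \<comment> \<open>Monotonicity was proved for positive times; cutting off at 1 gives a function
      monotone on all reals with the same limit at infinity.\<close>
    define f where "f t = d q (T (max 1 t) x)" for t
    have "\<exists>a. (f \<longlongrightarrow> a) at_top"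
    proof (rule decreasing_bounded_convergent_at_top)
      show "f t \<le> f s" if "s \<le> t" for s t
        unfolding f_def using that by (intro dist_semigroup_fixed_point_antimono[OF x q]) auto
    qed (simp add: f_def)
    then obtain a where a: "(f \<longlongrightarrow> a) at_top" ..
    have "\<forall>\<^sub>F t in at_top. f t = d q (T t x)"
      using eventually_ge_at_top[of 1] by eventually_elim (simp add: f_def max_absorb2)
    with a show ?thesis by (intro exI) (rule Lim_transform_eventually)
  qed
  show ?thesis
  proof (rule weakly_converges_fixed_point[OF bdd res dist])
    show "filterlim real at_top sequentially" by (rule filterlim_real_sequentially)
    show ?thesis
      if "g \<in> X" "F g = g"
        "\<And>\<tau>. filterlim \<tau> at_top sequentially \<Longrightarrow> range \<tau> \<subseteq> {0..} \<Longrightarrow> weakly_converges X d (\<lambda>n. T (\<tau> n) x) g"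
      for g
    proof -
      have "weakly_converges X d (\<lambda>n. T (\<tau> n) x) g"
        if "\<forall>n. 0 \<le> \<tau> n" "filterlim \<tau> at_top sequentially" for \<tau>
        using that by (intro \<open>\<And>\<tau>. _ \<Longrightarrow> _ \<Longrightarrow> weakly_converges X d (\<lambda>n. T (\<tau> n) x) g\<close>) auto
      then show ?thesis
        using \<open>g \<in> X\<close> \<open>F g = g\<close> unfolding weakly_converges_at_top_def by blast
    qed
  qed auto
qed

end

section \<open>Heat flows of the nonlinear Markov operator\<close>

theorem mainTheorem4:
  fixes M :: "'a measure" and p :: "'a \<Rightarrow> 'a measure" and D :: "'a set"
    and h :: "'a \<Rightarrow> 'h::metric_space" and f0 :: "('a \<Rightarrow> 'h) set"
  assumes complete: "complete_measure M"
    and kernel: "markov_kernel M p"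
    and symmetric: "symmetric_kernel M p"
    and target: "hadamard_space (UNIV :: 'h set) dist"
    and D: "D \<in> sets M"
    and h: "h \<in> borel_measurable M"
    and standing_L2: "hadamard_space (L2_space M D h) (L2_dist M)"
    and standing_P: "markov_op_well_defined M D h p"
      "nonexpansive_on (L2_space M D h) (L2_dist M) (markov_op M D h p)"
    and dirichlet: "\<exists>g\<in>L2_space M D h. markov_op M D h p g = g"
    and f0: "f0 \<in> L2_space M D h"
  shows "(\<forall>lam f. (\<forall>n\<ge>1. 0 < lam n) \<and> (\<Sum>n. ennreal ((lam (Suc n))\<^sup>2)) = \<infinity> \<and>
              f 0 = f0 \<and>
              (\<forall>n\<ge>1. f n = resolvent (L2_space M D h) (L2_dist M) (markov_op M D h p) (lam n) (f (n - 1)))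
            \<longrightarrow> (\<exists>g\<in>L2_space M D h. weakly_converges (L2_space M D h) (L2_dist M) f g \<and>
                                   markov_op M D h p g = g)) \<and>
         (\<exists>g\<in>L2_space M D h.
            weakly_converges_at_top (L2_space M D h) (L2_dist M)
              (\<lambda>t. semigroup_of (L2_space M D h) (L2_dist M) (markov_op M D h p) t f0) g \<and>
            markov_op M D h p g = g)"
proof -
  let ?X = "L2_space M D h" and ?d = "L2_dist M" and ?F = "markov_op M D h p"
  have "Metric_space ?X ?d"
    using standing_L2 by (simp add: hadamard_space_def)
  \<comment> \<open>The standing facts on \<open>L2_space\<close> and \<open>markov_op\<close>
    supply the assumptions of the abstract locale; a solution of the Dirichlet problem is the fixed
    point it asks for.\<close>
  then interpret nonexpansive_map ?X ?d ?F
    using standing_L2 standing_P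
    by (simp add: nonexpansive_map_def nonexpansive_map_axioms_def hadamard_def hadamard_axioms_def)
  have "\<exists>g\<in>?X. weakly_converges ?X ?d f g \<and> ?F g = g"
    if "\<forall>n\<ge>1. 0 < lam n" "(\<Sum>n. ennreal ((lam (Suc n))\<^sup>2)) = \<infinity>" "f 0 = f0"
      "\<forall>n\<ge>1. f n = resolvent ?X ?d ?F (lam n) (f (n - 1))" for lam f
    by (rule resolvent_sequence_weakly_converges[OF dirichlet]) (use that f0 in blast)+
  moreover have "\<exists>g\<in>?X. weakly_converges_at_top ?X ?d (\<lambda>t. semigroup_of ?X ?d ?F t f0) g \<and> ?F g = g"
    by (rule semigroup_weakly_converges[OF dirichlet f0])
  ultimately show ?thesis by blast
qed

end
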